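(* Let $S$ be a regular topological semigroup whose square $S\times S$ is countably compact. Then: (i) the inversion $\operatorname{inv}\colon H(S)\to H(S)$ is continuous; (ii) the projection $\pi\colon H(S)\to E(S)$ is continuous.
   Context: All topological spaces are assumed Hausdorff; regular means $T_3$ (regular and Hausdorff). A topological semigroup is a topological space with a continuous associative binary operation. A space $X$ is countably compact if every countable open cover of $X$ has a finite subcover. $E(S)$ denotes the set of idempotents of a semigroup $S$; for $e\in E(S)$, $H(e)$ is the maximal subgroup of $S$ with identity $e$; $H(S)=\bigcup_{e\in E(S)}H(e)$. The inversion $\operatorname{inv}\colon H(S)\to H(S)$ sends $x\in H(e)$ to its inverse $x^{-1}$ in the group $H(e)$, and the projection $\pi\colon H(S)\to E(S)$ is $\pi(x)=xx^{-1}$. Here $H(S)$ and $E(S)$ carry the subspace topologies from $S$. *)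

theory Defs
  imports "HOL-Analysis.Analysis" "HOL-Algebra.Group"
begin

definition idempotents :: "'a::semigroup_mult set" where
  "idempotents = {e. e * e = e}"

text \<open>The subset \<open>G\<close> of the ambient semigroup, with the semigroup multiplication and the
  distinguished element \<open>e\<close>, as a structure in the sense of HOL-Algebra.\<close>

definition sub_struct :: "'a::semigroup_mult \<Rightarrow> 'a set \<Rightarrow> 'a monoid" where
  "sub_struct e G = \<lparr>carrier = G, monoid.mult = (*), one = e\<rparr>"

text \<open>The inclusion-greatest subgroup with identity \<open>e\<close>; it exists for every idempotent \<open>e\<close>
  (lemmas \<open>group_maximal_subgroup\<close> and \<open>maximal_subgroup_greatest\<close> below). For \<open>e\<close> not
  idempotent there are no subgroups with identity \<open>e\<close> and the value is unspecified.\<close>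

definition maximal_subgroup :: "'a::semigroup_mult \<Rightarrow> 'a set" where
  "maximal_subgroup e = (GREATEST G. Group.group (sub_struct e G))"

definition clifford_part :: "'a::semigroup_mult set" where
  "clifford_part = (\<Union>e\<in>idempotents. maximal_subgroup e)"

text \<open>The description in \<open>semigroup_inv\<close> is meaningful on \<^const>\<open>clifford_part\<close> only: there the
  idempotent \<open>e\<close> is unique, see \<open>maximal_subgroups_disjoint\<close> below.\<close>

definition semigroup_inv :: "'a::semigroup_mult \<Rightarrow> 'a" where
  "semigroup_inv x = (THE y. \<exists>e\<in>idempotents. x \<in> maximal_subgroup e \<and>
     y = m_inv (sub_struct e (maximal_subgroup e)) x)"

definition semigroup_proj :: "'a::semigroup_mult \<Rightarrow> 'a" where
  "semigroup_proj x = x * semigroup_inv x"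

lemma sub_struct_simps [simp]:
  "carrier (sub_struct e G) = G" "monoid.mult (sub_struct e G) = (*)" "one (sub_struct e G) = e"
  by (simp_all add: sub_struct_def)

lemma group_sub_struct_iff:
  "Group.group (sub_struct e G) \<longleftrightarrow> e \<in> G \<and> (\<forall>x\<in>G. \<forall>y\<in>G. x * y \<in> G) \<and>
     (\<forall>x\<in>G. e * x = x \<and> x * e = x) \<and> (\<forall>x\<in>G. \<exists>y\<in>G. x * y = e \<and> y * x = e)"
  (is "?L \<longleftrightarrow> ?R")
proof
  assume ?L
  then interpret group "sub_struct e G" .
  have "\<exists>y\<in>G. x * y = e \<and> y * x = e" if "x \<in> G" for x
    using that l_inv[of x] r_inv[of x] inv_closed[of x] by auto
  then show ?R
    using one_closed m_closed l_one r_one by simp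
next
  assume ?R
  then show ?L by (intro groupI) (auto simp: mult.assoc)
qed

lemma maximal_subgroup_aux:
  fixes e :: "'a::semigroup_mult"
  assumes "e \<in> idempotents"
  defines "U \<equiv> {x. e * x = x \<and> x * e = x \<and>
                   (\<exists>y. e * y = y \<and> y * e = y \<and> x * y = e \<and> y * x = e)}"
  shows "Group.group (sub_struct e U)" "Group.group (sub_struct e G) \<Longrightarrow> G \<subseteq> U"
proof -
  have ee: "e * e = e" using assms(1) by (simp add: idempotents_def)
  have closed: "x * x' \<in> U" if xU: "x \<in> U" "x' \<in> U" for x x'
  proof -
    obtain y where y: "e * y = y" "y * e = y" "x * y = e" "y * x = e" "e * x = x" "x * e = x"
      using xU(1) unfolding U_def by blast
    obtain y' where y': "e * y' = y'" "y' * e = y'" "x' * y' = e" "y' * x' = e"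
        "e * x' = x'" "x' * e = x'"
      using xU(2) unfolding U_def by blast
    have "e * (x * x') = x * x'" "(x * x') * e = x * x'"
         "e * (y' * y) = y' * y" "(y' * y) * e = y' * y"
      using y y' by (simp_all add: mult.assoc flip: mult.assoc[of e])
    moreover have "(x * x') * (y' * y) = e"
    proof -
      have "(x * x') * (y' * y) = x * ((x' * y') * y)" by (simp only: mult.assoc)
      then show ?thesis using y y' by simp
    qed
    moreover have "(y' * y) * (x * x') = e"
    proof -
      have "(y' * y) * (x * x') = y' * ((y * x) * x')" by (simp only: mult.assoc)
      then show ?thesis using y y' by simp
    qed
    ultimately show ?thesis unfolding U_def by blast
  qed
  show "Group.group (sub_struct e U)"
    unfolding group_sub_struct_iff using ee closed by (auto simp: U_def)
  show "G \<subseteq> U" if "Group.group (sub_struct e G)"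
    using that unfolding group_sub_struct_iff U_def by blast
qed

lemma
  fixes e :: "'a::semigroup_mult"
  assumes "e \<in> idempotents"
  shows group_maximal_subgroup: "Group.group (sub_struct e (maximal_subgroup e))"
    and maximal_subgroup_greatest: "Group.group (sub_struct e G) \<Longrightarrow> G \<subseteq> maximal_subgroup e"
proof -
  note aux = maximal_subgroup_aux[OF assms]
  have eq: "maximal_subgroup e = {x. e * x = x \<and> x * e = x \<and>
              (\<exists>y. e * y = y \<and> y * e = y \<and> x * y = e \<and> y * x = e)}"
    unfolding maximal_subgroup_def by (rule Greatest_equality) (rule aux, erule aux)
  show "Group.group (sub_struct e (maximal_subgroup e))"
    unfolding eq by (rule aux)
  show "G \<subseteq> maximal_subgroup e" if "Group.group (sub_struct e G)"
    unfolding eq using that by (rule aux)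
qed

lemma maximal_subgroups_disjoint:
  assumes "e \<in> idempotents" "f \<in> idempotents" "x \<in> maximal_subgroup e" "x \<in> maximal_subgroup f"
  shows "e = f"
proof -
  have E: "e * x = x \<and> (\<exists>y. y * x = e \<and> x * y = e)"
    using group_maximal_subgroup[OF assms(1)] assms(3) unfolding group_sub_struct_iff by blast
  have F: "x * f = x \<and> (\<exists>z. z * x = f \<and> x * z = f)"
    using group_maximal_subgroup[OF assms(2)] assms(4) unfolding group_sub_struct_iff by blast
  obtain y z where y: "e * x = x" "y * x = e" and z: "x * f = x" "x * z = f"
    using E F by blast
  have "e = y * (x * f)" using y z by simp
  also have "\<dots> = e * f" using y by (simp flip: mult.assoc)
  also have "\<dots> = (e * x) * z" using z by (simp add: mult.assoc)
  also have "\<dots> = f" using y z by simp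
  finally show ?thesis .
qed

lemma semigroup_inv_eq:
  assumes "e \<in> idempotents" "x \<in> maximal_subgroup e"
  shows "semigroup_inv x = m_inv (sub_struct e (maximal_subgroup e)) x"
  unfolding semigroup_inv_def
  by (rule the_equality) (use assms in \<open>auto dest: maximal_subgroups_disjoint\<close>)

end

theory Submission
  imports Defs
begin

text \<open>
  The graph of the inversion is the set of pairs \<open>(x, y)\<close> with \<open>xy = yx\<close>, \<open>xyx = x\<close>, \<open>yxy = y\<close>,
  which is closed in \<open>S \<times> S\<close>. A cluster point \<open>(c, d)\<close> of the sequence \<open>(x\<^sup>n, x\<^sup>-\<^sup>n)\<close> satisfies
  \<open>cd = xx\<^sup>-\<^sup>1\<close>, so \<open>x\<^sup>-\<^sup>1x\<^sup>nx\<^sup>-\<^sup>m\<close> is close to \<open>x\<^sup>-\<^sup>1\<close> for suitable \<open>n > m + 1\<close>; hence \<open>x\<^sup>-\<^sup>1\<close> lies in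
  the closure of the positive powers of \<open>x\<close>.

  Suppose that the inversion is discontinuous at an idempotent \<open>e\<close>, as witnessed by a neighbourhood
  \<open>U\<close>. Choose neighbourhoods \<open>V\<^sub>n \<subseteq> U\<close> of \<open>e\<close> with \<open>cl V\<^sub>n\<^sub>+\<^sub>1 \<subseteq> V\<^sub>n\<close>, \<open>V\<^sub>n\<^sub>+\<^sub>1V\<^sub>n\<^sub>+\<^sub>1 \<subseteq> V\<^sub>n\<close>, and points
  \<open>x\<^sub>n \<in> V\<^sub>n\<close> with \<open>x\<^sub>n\<^sup>-\<^sup>1 \<notin> U\<close>. The pairs \<open>(x\<^sub>n, x\<^sub>n\<^sup>-\<^sup>1)\<close> cluster at some \<open>(a, a\<^sup>-\<^sup>1)\<close> with \<open>a\<close> in the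
  closed subsemigroup \<open>\<Inter>V\<^sub>n\<close> and \<open>a\<^sup>-\<^sup>1 \<notin> U\<close>. But \<open>a\<^sup>-\<^sup>1\<close> is in the closure of the powers of \<open>a\<close>, thus
  in \<open>\<Inter>V\<^sub>n \<subseteq> U\<close>.

  At a general point \<open>x\<close>, pick \<open>k\<close> with \<open>x\<^sup>k\<close> close to \<open>x\<^sup>-\<^sup>1\<close> and \<open>x\<^sup>k\<^sup>+\<^sup>1\<close> close to \<open>xx\<^sup>-\<^sup>1\<close>; then
  continuity at \<open>xx\<^sup>-\<^sup>1\<close> makes \<open>z\<^sup>-\<^sup>1 = z\<^sup>k(z\<^sup>k\<^sup>+\<^sup>1)\<^sup>-\<^sup>1\<close> close to \<open>x\<^sup>-\<^sup>1\<close> for \<open>z\<close> close to \<open>x\<close>.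
\<close>

section \<open>Cluster points, regularity and neighbourhoods of products\<close>

lemma countably_compact_cluster_point:
  fixes s :: "nat \<Rightarrow> 'a::topological_space"
  assumes "countably_compact (UNIV :: 'a set)"
  obtains z where "\<And>W n. open W \<Longrightarrow> z \<in> W \<Longrightarrow> \<exists>m\<ge>n. s m \<in> W"
proof -
  \<comment> \<open>These closures have the finite intersection property, and a point common to all
    of them is a cluster point.\<close>
  define C where "C n = closure (s ` {n..})" for n
  have "\<exists>z. \<forall>n. z \<in> C n"
  proof (rule ccontr)
    assume "\<not> ?thesis"
    then have "UNIV \<subseteq> \<Union>(range (\<lambda>n. - C n))" by blast
    moreover have "countable (range (\<lambda>n. - C n))" "\<forall>A\<in>range (\<lambda>n. - C n). open A"
      by (auto simp: C_def)
    ultimately obtain T where "T \<subseteq> range (\<lambda>n. - C n)" "finite T" "UNIV \<subseteq> \<Union>T"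
      using assms unfolding countably_compact_def by metis
    then obtain N where N: "finite N" "UNIV \<subseteq> \<Union>((\<lambda>n. - C n) ` N)"
      by (metis finite_subset_image)
    then obtain k where "k \<in> N" "s (Max N) \<notin> C k" by blast
    moreover have "s (Max N) \<in> C k"
      unfolding C_def using N(1) \<open>k \<in> N\<close> by (intro subsetD[OF closure_subset]) auto
    ultimately show False by blast
  qed
  then obtain z where z: "\<And>n. z \<in> C n" by blast
  show thesis
  proof (rule that)
    fix W n assume W: "open W" "z \<in> W"
    then have "W \<inter> s ` {n..} \<noteq> {}"
      using z[of n] unfolding C_def by (metis IntI empty_iff open_Int_closure_eq_empty)
    then show "\<exists>m\<ge>n. s m \<in> W" by auto
  qed
qed

lemma cluster_point_in_closed:
  assumes "closed C" "\<And>W n. open W \<Longrightarrow> z \<in> W \<Longrightarrow> \<exists>m\<ge>n. s m \<in> W"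
    and "\<And>m. m \<ge> (k::nat) \<Longrightarrow> s m \<in> C"
  shows "z \<in> C"
  using assms(1) assms(2)[of "- C" k] assms(3) by (meson ComplD ComplI open_Compl)

lemma t3_space_shrink:
  fixes x :: "'a::t3_space"
  assumes "open U" "x \<in> U"
  obtains V where "open V" "x \<in> V" "closure V \<subseteq> U"
proof -
  obtain V W where VW: "open V" "open W" "x \<in> V" "- U \<subseteq> W" "V \<inter> W = {}"
    using t3_space[of "- U" x] assms by auto
  then have "closure V \<subseteq> - W"
    by (intro closure_minimal) auto
  then show thesis using VW that by blast
qed

lemma open_mult_nbhds:
  fixes a b :: "'a::topological_semigroup_mult"
  assumes "open W" "a * b \<in> W"
  obtains A B where "open A" "open B" "a \<in> A" "b \<in> B" "\<And>x y. x \<in> A \<Longrightarrow> y \<in> B \<Longrightarrow> x * y \<in> W"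
proof -
  have "continuous_on UNIV (\<lambda>p::'a \<times> 'a. fst p * snd p)"
    by (intro continuous_intros)
  then have "open ((\<lambda>p::'a \<times> 'a. fst p * snd p) -` W)"
    using assms(1) by (rule open_vimage[rotated])
  then obtain A B where "open A" "open B" "(a, b) \<in> A \<times> B"
      "A \<times> B \<subseteq> (\<lambda>p::'a \<times> 'a. fst p * snd p) -` W"
    using assms(2) by (elim open_prod_elim[where x = "(a, b)"]) auto
  then show thesis by (intro that[of A B]) auto
qed

section \<open>Group inverses as an equational relation\<close>

text \<open>The subgroup stays implicit: its identity is recovered as \<open>x * y\<close>, so the
  relation passes to cluster points of pairs.\<close>

definition group_inverse :: "'a::semigroup_mult \<Rightarrow> 'a \<Rightarrow> bool" where
  "group_inverse x y \<longleftrightarrow> x * y = y * x \<and> x * y * x = x \<and> y * x * y = y"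

lemma group_inverse_sym: "group_inverse x y \<Longrightarrow> group_inverse y x"
  unfolding group_inverse_def by metis

lemma group_inverseD:
  assumes "group_inverse x y"
  shows "x * y = y * x" "x * (y * x) = x" "x * (x * y) = x" "y * (x * y) = y" "y * (y * x) = y"
    "x * (y * y) = y"
  using assms unfolding group_inverse_def by (metis mult.assoc)+

lemma closed_group_inverse:
  "closed {p :: 'a::{t2_space, topological_semigroup_mult} \<times> 'a. group_inverse (fst p) (snd p)}"
  unfolding group_inverse_def by (intro closed_Collect_conj closed_Collect_eq continuous_intros)

lemma group_inverse_idempotent: "group_inverse x y \<Longrightarrow> x * y \<in> idempotents"
  by (simp add: idempotents_def mult.assoc group_inverseD(4))

lemma group_inverse_semigroup_inv:
  assumes "x \<in> clifford_part"
  shows "group_inverse x (semigroup_inv x)"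
proof -
  obtain e where e: "e \<in> idempotents" "x \<in> maximal_subgroup e"
    using assms unfolding clifford_part_def by blast
  interpret group "sub_struct e (maximal_subgroup e)"
    using e(1) by (rule group_maximal_subgroup)
  show ?thesis
    using e l_inv[of x] r_inv[of x] l_one[of x] inv_closed[of x]
      l_one[of "inv\<^bsub>sub_struct e (maximal_subgroup e)\<^esub> x"]
    by (simp add: semigroup_inv_eq group_inverse_def)
qed

lemma group_inverse_clifford_part:
  assumes "group_inverse x y"
  shows "x \<in> clifford_part"
proof -
  define e where "e = x * y"
  have e: "e \<in> idempotents"
    using assms unfolding e_def by (rule group_inverse_idempotent)
  \<comment> \<open>\<open>G\<close> is the group of units of the monoid eSe.\<close>
  define G where "G = {x. e * x = x \<and> x * e = x \<and>
                   (\<exists>y. e * y = y \<and> y * e = y \<and> x * y = e \<and> y * x = e)}"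
  have "Group.group (sub_struct e G)"
    unfolding G_def using e by (rule maximal_subgroup_aux)
  then have "G \<subseteq> maximal_subgroup e"
    using e by (intro maximal_subgroup_greatest)
  moreover have "e * x = x" "x * e = x" "e * y = y" "y * e = y" "x * y = e" "y * x = e"
    using group_inverseD[OF assms] unfolding e_def by (metis mult.assoc)+
  then have "x \<in> G"
    unfolding G_def by blast
  ultimately show ?thesis
    using e unfolding clifford_part_def by blast
qed

section \<open>Powers and their cancellation\<close>

text \<open>The exponent is shifted by one: \<open>semigroup_pow x n\<close> is the power \<open>x\<^sup>n\<^sup>+\<^sup>1\<close>.\<close>

primrec semigroup_pow :: "'a::semigroup_mult \<Rightarrow> nat \<Rightarrow> 'a" where
  "semigroup_pow x 0 = x"
| "semigroup_pow x (Suc n) = x * semigroup_pow x n"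

lemma continuous_on_semigroup_pow:
  "continuous_on A (\<lambda>x::'a::topological_semigroup_mult. semigroup_pow x n)"
  by (induction n) (auto intro!: continuous_intros)

context
  fixes x y :: "'a::semigroup_mult"
  assumes inverse: "group_inverse x y"
begin

lemma idempotent_mult_semigroup_pow: "x * (y * semigroup_pow x n) = semigroup_pow x n"
  using group_inverseD[OF inverse] by (cases n) (simp_all flip: mult.assoc)

lemma inverse_mult_semigroup_pow_Suc: "y * semigroup_pow x (Suc n) = semigroup_pow x n"
  using idempotent_mult_semigroup_pow[of n] group_inverseD(1)[OF inverse]
  by (simp flip: mult.assoc)

lemma semigroup_pow_Suc_mult_inverse: "semigroup_pow x (Suc n) * y = semigroup_pow x n"
proof (induction n)
  case 0
  show ?case using group_inverseD[OF inverse] by (simp add: mult.assoc)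
next
  case (Suc n)
  then show ?case by (simp add: mult.assoc)
qed

lemma semigroup_pow_Suc_mult_Suc:
  "semigroup_pow x (Suc n) * semigroup_pow y (Suc m) = semigroup_pow x n * semigroup_pow y m"
proof -
  have "semigroup_pow x (Suc n) * semigroup_pow y (Suc m) =
      (semigroup_pow x (Suc n) * y) * semigroup_pow y m"
    by (simp add: mult.assoc)
  then show ?thesis by (simp only: semigroup_pow_Suc_mult_inverse)
qed

lemma semigroup_pow_mult_same: "semigroup_pow x n * semigroup_pow y n = x * y"
  by (induction n) (simp_all only: semigroup_pow_Suc_mult_Suc semigroup_pow.simps(1))

lemma semigroup_pow_mult_larger: "semigroup_pow x n * semigroup_pow y (Suc n) = y"
proof (induction n)
  case 0
  show ?case using group_inverseD[OF inverse] by simp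
qed (simp only: semigroup_pow_Suc_mult_Suc)

lemma semigroup_pow_mult_smaller: "semigroup_pow x (Suc (n + m)) * semigroup_pow y m = semigroup_pow x n"
proof (induction m)
  case 0
  show ?case by (simp only: semigroup_pow_Suc_mult_inverse add_0_right semigroup_pow.simps(1))
qed (simp only: semigroup_pow_Suc_mult_Suc add_Suc_right)

end

text \<open>In either order the two powers multiply to the idempotent \<open>x * y\<close>, which
  acts on both as an identity.\<close>

lemma group_inverse_semigroup_pow:
  assumes "group_inverse x y"
  shows "group_inverse (semigroup_pow x n) (semigroup_pow y n)"
  using semigroup_pow_mult_same[OF assms, of n] idempotent_mult_semigroup_pow[OF assms, of n]
    semigroup_pow_mult_same[OF group_inverse_sym[OF assms], of n]
    idempotent_mult_semigroup_pow[OF group_inverse_sym[OF assms], of n] group_inverseD(1)[OF assms]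
  unfolding group_inverse_def by (metis mult.assoc)

lemma inverse_in_closure_powers:
  fixes x y :: "'a::{t2_space, topological_semigroup_mult}"
  assumes "countably_compact (UNIV :: ('a \<times> 'a) set)" "group_inverse x y" "open W" "y \<in> W"
  obtains k where "semigroup_pow x k \<in> W"
proof -
  define s where "s n = (semigroup_pow x n, semigroup_pow y n)" for n
  obtain z where z: "\<And>W n. open W \<Longrightarrow> z \<in> W \<Longrightarrow> \<exists>m\<ge>n. s m \<in> W"
    using countably_compact_cluster_point[OF assms(1), of s] by metis
  obtain c d where cd: "z = (c, d)" by (cases z)
  have "z \<in> {p. fst p * snd p = x * y}"
    using z by (rule cluster_point_in_closed[rotated])
      (auto intro!: closed_Collect_eq continuous_intros
        simp: s_def semigroup_pow_mult_same[OF assms(2)])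
  then have "y * (c * d) \<in> W"
    using cd assms(4) group_inverseD[OF assms(2)] by simp
  then obtain Y E where E: "open E" "c * d \<in> E" "\<And>u. u \<in> E \<Longrightarrow> y * u \<in> W" and "y \<in> Y"
    using open_mult_nbhds[OF assms(3)] by metis
  obtain C D where CD: "open C" "open D" "c \<in> C" "d \<in> D" "\<And>u v. u \<in> C \<Longrightarrow> v \<in> D \<Longrightarrow> u * v \<in> E"
    using open_mult_nbhds[OF E(1,2)] by metis
  have nbhd: "open (C \<times> D)" "z \<in> C \<times> D"
    using CD cd by (auto intro: open_Times)
  obtain m where m: "s m \<in> C \<times> D"
    using z[OF nbhd] by metis
  \<comment> \<open>With \<open>n = j + m + 2\<close>, the product of \<open>y\<close>, x^(n+1) and
    y^(m+1) is x^(j+1), that is \<open>semigroup_pow x j\<close>; a smaller gap would not leave a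
    positive exponent.\<close>
  obtain n where n: "n \<ge> Suc (Suc m)" "s n \<in> C \<times> D"
    using z[OF nbhd] by metis
  obtain j where j: "n = Suc (Suc (j + m))"
    using n(1) by (metis add.commute add_Suc le_Suc_ex)
  have "y * (semigroup_pow x n * semigroup_pow y m) \<in> W"
    using m n CD E by (auto simp: s_def)
  also have "y * (semigroup_pow x n * semigroup_pow y m) =
      y * semigroup_pow x (Suc (Suc (j + m))) * semigroup_pow y m"
    by (simp only: mult.assoc j)
  also have "\<dots> = semigroup_pow x j"
    by (simp only: inverse_mult_semigroup_pow_Suc[OF assms(2)] semigroup_pow_mult_smaller[OF assms(2)])
  finally show thesis by (rule that)
qed

section \<open>Continuity at idempotents, then at general points\<close>

lemma group_inverse_nbhd_idempotent:
  fixes e :: "'a::{t3_space, topological_semigroup_mult}"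
  assumes cc: "countably_compact (UNIV :: ('a \<times> 'a) set)"
    and e: "e \<in> idempotents" and U: "open U" "e \<in> U"
  shows "\<exists>V. open V \<and> e \<in> V \<and> (\<forall>x y. group_inverse x y \<longrightarrow> x \<in> V \<longrightarrow> y \<in> U)"
proof (rule ccontr)
  assume no_nbhd: "\<not> ?thesis"
  have bad: "\<exists>x y. group_inverse x y \<and> x \<in> V \<and> y \<notin> U" if "open V" "e \<in> V" for V
    using no_nbhd that by blast
  have "\<exists>V. \<forall>n. (open (V n) \<and> e \<in> V n \<and> V n \<subseteq> U) \<and>
      (closure (V (Suc n)) \<subseteq> V n \<and> (\<forall>a\<in>V (Suc n). \<forall>b\<in>V (Suc n). a * b \<in> V n))"
  proof (rule dependent_nat_choice)
    show "\<exists>V. open V \<and> e \<in> V \<and> V \<subseteq> U"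
      using U by blast
    fix V :: "'a set" and n :: nat
    assume V: "open V \<and> e \<in> V \<and> V \<subseteq> U"
    then have "e * e \<in> V" using e by (simp add: idempotents_def)
    then obtain A B where AB: "open A" "open B" "e \<in> A" "e \<in> B"
        "\<And>x y. x \<in> A \<Longrightarrow> y \<in> B \<Longrightarrow> x * y \<in> V"
      using V open_mult_nbhds by metis
    obtain V' where V': "open V'" "e \<in> V'" "closure V' \<subseteq> A \<inter> B \<inter> V"
      using t3_space_shrink[of "A \<inter> B \<inter> V" e] AB V by auto
    then have "V' \<subseteq> A \<inter> B \<inter> V"
      using closure_subset by blast
    then show "\<exists>V'. (open V' \<and> e \<in> V' \<and> V' \<subseteq> U) \<and>
        (closure V' \<subseteq> V \<and> (\<forall>a\<in>V'. \<forall>b\<in>V'. a * b \<in> V))"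
      using V V' AB(5) by (intro exI[of _ V']) blast
  qed
  then obtain V where V: "\<And>n. open (V n)" "\<And>n. e \<in> V n" "\<And>n. V n \<subseteq> U"
      "\<And>n. closure (V (Suc n)) \<subseteq> V n"
      "\<And>n a b. a \<in> V (Suc n) \<Longrightarrow> b \<in> V (Suc n) \<Longrightarrow> a * b \<in> V n"
    by metis
  have mono: "V m \<subseteq> V n" if "n \<le> m" for n m
    using that by (rule lift_Suc_antimono_le[rotated]) (use V(4) closure_subset in blast)
  have "\<forall>n. \<exists>p. group_inverse (fst p) (snd p) \<and> fst p \<in> V n \<and> snd p \<notin> U"
    using bad[OF V(1,2)] by simp
  then obtain s where s: "\<And>n. group_inverse (fst (s n)) (snd (s n))" "\<And>n. fst (s n) \<in> V n"
      "\<And>n. snd (s n) \<notin> U"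
    by metis
  obtain z where z: "\<And>W n. open W \<Longrightarrow> z \<in> W \<Longrightarrow> \<exists>m\<ge>n. s m \<in> W"
    using countably_compact_cluster_point[OF cc, of s] by metis
  obtain a b where ab: "z = (a, b)" by (cases z)
  have "z \<in> {p. group_inverse (fst p) (snd p)}"
    using closed_group_inverse z by (rule cluster_point_in_closed) (use s in auto)
  then have inv: "group_inverse a b" using ab by simp
  have "z \<in> UNIV \<times> (- U)"
    using z by (rule cluster_point_in_closed[rotated])
      (use s(3) U in \<open>auto intro!: closed_Times simp: mem_Times_iff\<close>)
  then have "b \<notin> U" using ab by simp
  have a: "a \<in> V n" for n
  proof -
    have "z \<in> closure (V (Suc n)) \<times> UNIV"
      using z
    proof (rule cluster_point_in_closed[rotated])
      fix m assume "Suc n \<le> m"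
      then have "fst (s m) \<in> V (Suc n)" using s(2) mono by blast
      then show "s m \<in> closure (V (Suc n)) \<times> UNIV"
        using closure_subset by (auto simp: mem_Times_iff)
    qed (auto intro: closed_Times)
    then show ?thesis using ab V(4) by blast
  qed
  \<comment> \<open>Each multiplication costs one level of the chain, hence the induction with
    \<open>n\<close> arbitrary.\<close>
  have pow: "semigroup_pow a k \<in> V n" for k n
    by (induction k arbitrary: n) (simp_all add: a V(5))
  \<comment> \<open>\<open>closure (V 1)\<close> lies in \<open>V 0\<close>, hence in
    \<open>U\<close>, and so misses \<open>b\<close>.\<close>
  have "open (- closure (V 1))" "b \<in> - closure (V 1)"
    using \<open>b \<notin> U\<close> V(3,4)[of 0] by auto
  then obtain k where "semigroup_pow a k \<in> - closure (V 1)"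
    using inverse_in_closure_powers[OF cc inv] by blast
  then show False using pow[of k 1] closure_subset by blast
qed

lemma group_inverse_nbhd:
  fixes x y :: "'a::{t3_space, topological_semigroup_mult}"
  assumes cc: "countably_compact (UNIV :: ('a \<times> 'a) set)"
    and inv: "group_inverse x y" and U: "open U" "y \<in> U"
  obtains V where "open V" "x \<in> V" "\<And>z w. group_inverse z w \<Longrightarrow> z \<in> V \<Longrightarrow> w \<in> U"
proof -
  \<comment> \<open>In this splitting \<open>A\<close> is to contain z^(k+1) and \<open>B\<close> is
    to contain w^(k+2); their product is \<open>w\<close>.\<close>
  have "y * (x * y) \<in> U"
    using U group_inverseD[OF inv] by simp
  then obtain A B where AB: "open A" "open B" "y \<in> A" "x * y \<in> B"
      "\<And>u v. u \<in> A \<Longrightarrow> v \<in> B \<Longrightarrow> u * v \<in> U"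
    using open_mult_nbhds[OF U(1)] by metis
  obtain C where C: "open C" "x * y \<in> C" "\<And>z w. group_inverse z w \<Longrightarrow> z \<in> C \<Longrightarrow> w \<in> B"
    using group_inverse_nbhd_idempotent[OF cc group_inverse_idempotent[OF inv] AB(2,4)] by metis
  \<comment> \<open>A single \<open>k\<close> suffices: if x^(k+1) lies in \<open>D\<close>, then
    x^(k+2) lies in \<open>C\<close>.\<close>
  obtain X D where D: "x \<in> X" "open D" "y \<in> D" "\<And>u v. u \<in> X \<Longrightarrow> v \<in> D \<Longrightarrow> u * v \<in> C"
    using open_mult_nbhds[OF C(1,2)] by metis
  obtain k where k: "semigroup_pow x k \<in> A \<inter> D"
    using inverse_in_closure_powers[OF cc inv, of "A \<inter> D"] AB D by auto
  define V where "V = (\<lambda>z. semigroup_pow z k) -` A \<inter> (\<lambda>z. semigroup_pow z (Suc k)) -` C"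
  show thesis
  proof
    show "open V"
      unfolding V_def by (intro open_Int open_vimage AB C continuous_on_semigroup_pow)
    show "x \<in> V"
      using k D by (simp add: V_def)
    fix z w assume zw: "group_inverse z w" "z \<in> V"
    have "semigroup_pow w (Suc k) \<in> B"
      using C(3)[OF group_inverse_semigroup_pow[OF zw(1), of "Suc k"]] zw(2)
      by (simp add: V_def)
    then have "semigroup_pow z k * semigroup_pow w (Suc k) \<in> U"
      using zw(2) AB(5) by (simp add: V_def)
    then show "w \<in> U"
      by (simp only: semigroup_pow_mult_larger[OF zw(1)])
  qed
qed

theorem theorem7:
  assumes "countably_compact (UNIV :: ('a::{t3_space, topological_semigroup_mult} \<times> 'a) set)"
  shows "continuous_map (top_of_set clifford_part) (top_of_set clifford_part)
           (semigroup_inv :: 'a \<Rightarrow> 'a) \<and>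
         continuous_map (top_of_set clifford_part) (top_of_set idempotents)
           (semigroup_proj :: 'a \<Rightarrow> 'a)"
proof -
  have inv: "continuous_on clifford_part (semigroup_inv :: 'a \<Rightarrow> 'a)"
    unfolding continuous_on_topological
  proof (intro ballI allI impI)
    fix x :: 'a and U assume "x \<in> clifford_part" "open U" "semigroup_inv x \<in> U"
    then obtain V where V: "open V" "x \<in> V" "\<And>z w. group_inverse z w \<Longrightarrow> z \<in> V \<Longrightarrow> w \<in> U"
      using group_inverse_nbhd[OF assms group_inverse_semigroup_inv] by metis
    then show "\<exists>A. open A \<and> x \<in> A \<and> (\<forall>y\<in>clifford_part. y \<in> A \<longrightarrow> semigroup_inv y \<in> U)"
      using group_inverse_semigroup_inv by blast
  qed
  then have "continuous_on clifford_part (semigroup_proj :: 'a \<Rightarrow> 'a)"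
    unfolding semigroup_proj_def by (intro continuous_intros)
  \<comment> \<open>Symmetry of \<open>group_inverse\<close> keeps the inverse in the Clifford
    part.\<close>
  moreover have "semigroup_inv x \<in> clifford_part" "semigroup_proj x \<in> idempotents"
    if "x \<in> clifford_part" for x :: 'a
    unfolding semigroup_proj_def using group_inverse_semigroup_inv[OF that]
    by (blast intro: group_inverse_clifford_part group_inverse_sym group_inverse_idempotent)+
  ultimately show ?thesis
    using inv by (auto simp: continuous_map_in_subtopology)
qed

end
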